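(* Let $G$ be a graph that contains a triangle or has fewer than $|V(G)|$ linearly independent chordless odd cycles. Then $G$ satisfies the active edge hypothesis: for every optimal basic feasible solution $x^0$ of $\mathrm{ELP}(G)$, at least one of the following holds: (1) $G$ contains a 3-cycle; (2) there is an edge $(i,j)$ of $G$ with $x^0_i+x^0_j=1$; (3) there is an edge $(i,j)$ of $G$ with $x^0_i+x^0_j\ge\frac43$; (4) $x^0_i=1$ for some vertex $i$.
   Context: For a graph $H$ on vertices $\{1,\ldots,n\}$, $\mathrm{ELP}(H)$ is the linear program: minimize $\sum_{v} x_v$ subject to $x_u+x_v\ge 1$ for every edge $(u,v)$ of $H$, $\sum_{v\in V(C)} x_v\ge s+1$ for every odd cycle $C$ of $H$ with $2s+1$ vertices, and $x\ge 0$; a basic feasible solution is a vertex of its feasible polyhedron. The incidence vector of a cycle $C$ is $\tau_C\in\{0,1\}^n$ with $\tau_C(i)=1$ iff $i\in V(C)$. A collection of odd cycles is linearly independent if their incidence vectors are linearly independent. A chordless odd cycle is an odd cycle with no edge of the graph joining two non-consecutive vertices of the cycle.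
   Formalization: If G contains no triangle, G is additionally assumed to have no isolated vertices; without this the claim fails, e.g. for a single vertex with no edges, where the only optimal solution is 0 and none of (1)–(4) holds. *)

theory Defs
  imports "HOL-Analysis.Analysis"
begin

text \<open>
  A finite simple graph is given by its adjacency relation; its vertex set is the whole finite
  index type, so that points of the linear program are vectors in \<open>real ^ 'n\<close> and \<open>|V(G)|\<close> is
  \<open>CARD('n)\<close>.
\<close>

definition simple_graph :: "('n \<Rightarrow> 'n \<Rightarrow> bool) \<Rightarrow> bool" where
  "simple_graph E \<longleftrightarrow> symp E \<and> irreflp E"

text \<open>
  Isolated vertices have to be excluded for triangle-free graphs: on an edgeless graph the only
  optimal point is \<open>0\<close>, and none of the four alternatives of the active edge hypothesis holds.
\<close>

definition no_isolated_vertices :: "('n \<Rightarrow> 'n \<Rightarrow> bool) \<Rightarrow> bool" where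
  "no_isolated_vertices E \<longleftrightarrow> (\<forall>v. \<exists>u. E v u)"

text \<open>
  A cycle is represented by the list of its vertices in cyclic order. The same cycle has several
  such lists (rotations and reversals); they all have the same incidence vector.
\<close>

definition is_cycle :: "('n \<Rightarrow> 'n \<Rightarrow> bool) \<Rightarrow> 'n list \<Rightarrow> bool" where
  "is_cycle E c \<longleftrightarrow>
     3 \<le> length c \<and> distinct c \<and>
     (\<forall>i < length c. E (c ! i) (c ! (Suc i mod length c)))"

definition odd_cycle :: "('n \<Rightarrow> 'n \<Rightarrow> bool) \<Rightarrow> 'n list \<Rightarrow> bool" where
  "odd_cycle E c \<longleftrightarrow> is_cycle E c \<and> odd (length c)"

definition chordless_odd_cycle :: "('n \<Rightarrow> 'n \<Rightarrow> bool) \<Rightarrow> 'n list \<Rightarrow> bool" where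
  "chordless_odd_cycle E c \<longleftrightarrow>
     odd_cycle E c \<and>
     (\<forall>i < length c. \<forall>j < length c.
        i \<noteq> j \<and> j \<noteq> Suc i mod length c \<and> i \<noteq> Suc j mod length c \<longrightarrow> \<not> E (c ! i) (c ! j))"

definition contains_triangle :: "('n \<Rightarrow> 'n \<Rightarrow> bool) \<Rightarrow> bool" where
  "contains_triangle E \<longleftrightarrow> (\<exists>c. is_cycle E c \<and> length c = 3)"

definition incidence_vector :: "'n::finite list \<Rightarrow> real ^ 'n" where
  "incidence_vector c = (\<chi> i. if i \<in> set c then 1 else 0)"

text \<open>
  Linear independence is that of the family of incidence vectors indexed by the collection:
  cycles with equal incidence vectors (in particular two lists for the same cycle) are dependent,
  hence the injectivity requirement.
\<close>

definition lin_indep_cycles :: "'n::finite list set \<Rightarrow> bool" where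
  "lin_indep_cycles C \<longleftrightarrow> inj_on incidence_vector C \<and> independent (incidence_vector ` C)"

text \<open>Linearly independent collections are finite, so \<open>card\<close> is their true size.\<close>

definition few_indep_chordless_odd_cycles :: "('n::finite \<Rightarrow> 'n \<Rightarrow> bool) \<Rightarrow> bool" where
  "few_indep_chordless_odd_cycles E \<longleftrightarrow>
     (\<forall>C. (\<forall>c \<in> C. chordless_odd_cycle E c) \<and> lin_indep_cycles C \<longrightarrow> card C < CARD('n))"

definition elp_feasible :: "('n::finite \<Rightarrow> 'n \<Rightarrow> bool) \<Rightarrow> (real ^ 'n) set" where
  "elp_feasible E =
     {x. (\<forall>u v. E u v \<longrightarrow> x $ u + x $ v \<ge> 1) \<and>
         (\<forall>c s. odd_cycle E c \<and> length c = 2 * s + 1 \<longrightarrow> (\<Sum>v \<in> set c. x $ v) \<ge> real s + 1) \<and>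
         (\<forall>v. x $ v \<ge> 0)}"

definition elp_optimal :: "('n::finite \<Rightarrow> 'n \<Rightarrow> bool) \<Rightarrow> real ^ 'n \<Rightarrow> bool" where
  "elp_optimal E x \<longleftrightarrow>
     x \<in> elp_feasible E \<and> (\<forall>y \<in> elp_feasible E. (\<Sum>v \<in> UNIV. x $ v) \<le> (\<Sum>v \<in> UNIV. y $ v))"

definition elp_basic_feasible :: "('n::finite \<Rightarrow> 'n \<Rightarrow> bool) \<Rightarrow> real ^ 'n \<Rightarrow> bool" where
  "elp_basic_feasible E x \<longleftrightarrow> x extreme_point_of elp_feasible E"

definition active_edge_hypothesis :: "('n::finite \<Rightarrow> 'n \<Rightarrow> bool) \<Rightarrow> bool" where
  "active_edge_hypothesis E \<longleftrightarrow>
     (\<forall>x. elp_basic_feasible E x \<and> elp_optimal E x \<longrightarrow>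
        contains_triangle E \<or>
        (\<exists>i j. E i j \<and> x $ i + x $ j = 1) \<or>
        (\<exists>i j. E i j \<and> x $ i + x $ j \<ge> 4 / 3) \<or>
        (\<exists>i. x $ i = 1))"

end

theory Submission
  imports Defs
begin

text \<open>
  Assume that \<open>G\<close> is triangle-free and that all edge constraints are slack at the optimal vertex
  \<open>x\<close>. A path on an even number of vertices is perfectly matched by its edges, so it weighs at
  least half its length. Deleting a vertex \<open>u\<close> with \<open>x u > 1\<close> from an odd cycle leaves such a path,
  so every cycle constraint at \<open>u\<close> is slack and \<open>x u\<close> could be decreased; hence \<open>x \<le> 1\<close>. A zero
  coordinate would force a neighbour of weight \<open>1\<close>, so \<open>x\<close> is positive and the only
  active constraints are odd cycles. A chord cuts an odd cycle into a smaller odd cycle and an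
  even path of weight more than half its length, so the active odd cycles are
  chordless. As \<open>x\<close> is a vertex, their incidence vectors span the whole space.
\<close>

section \<open>Odd cycles as closed lists of vertices\<close>

text \<open>Replaces the index modulo the length by a path with a closing edge, a form that splits
  along \<open>@\<close> and \<open>#\<close> when cycles are cut and rotated.\<close>

lemma is_cycle_iff_successively:
  "is_cycle E c \<longleftrightarrow> 3 \<le> length c \<and> distinct c \<and> successively E c \<and> E (last c) (hd c)"
proof (cases "3 \<le> length c")
  case True
  then have ne: "c \<noteq> []" by auto
  define m where "m = length c - 1"
  have m: "length c = Suc m" using True by (simp add: m_def)
  have "(\<forall>i < length c. E (c ! i) (c ! (Suc i mod length c))) \<longleftrightarrow>
      (\<forall>i < m. E (c ! i) (c ! Suc i)) \<and> E (c ! m) (c ! 0)"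
    unfolding m less_Suc_eq by auto
  also have "\<dots> \<longleftrightarrow> successively E c \<and> E (last c) (hd c)"
    using ne m by (auto simp: successively_conv_nth last_conv_nth hd_conv_nth)
  finally show ?thesis unfolding is_cycle_def by blast
qed (simp add: is_cycle_def)

lemma odd_cycle_rotate:
  assumes "odd_cycle E (as @ bs)"
  shows "odd_cycle E (bs @ as)"
proof (cases "as = [] \<or> bs = []")
  case False
  then show ?thesis
    using assms
    by (auto simp: odd_cycle_def is_cycle_iff_successively successively_append_iff)
qed (use assms in auto)

lemma finite_odd_cycles: "finite {c :: 'n::finite list. odd_cycle E c}"
  by (rule finite_subset[OF _ finite_subset_distinct[of UNIV]])
     (auto simp: odd_cycle_def is_cycle_def)

section \<open>Weights of even paths and tight odd cycles\<close>

lemma even_path_weight: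
  fixes f :: "'a \<Rightarrow> real"
  assumes "\<And>u v. E u v \<Longrightarrow> f u + f v > 1" "successively E p" "even (length p)"
  shows "sum_list (map f p) \<ge> length p / 2 \<and> (p \<noteq> [] \<longrightarrow> sum_list (map f p) > length p / 2)"
  using assms(2,3)
proof (induction "length p" arbitrary: p rule: less_induct)
  case less
  show ?case
  proof (cases p)
    case (Cons u q)
    with less.prems obtain v r where p: "p = u # v # r"
      by (cases q) auto
    \<comment> \<open>Only the weak bound is available for \<open>r\<close>, which may be empty;
      strictness comes from the edge \<open>u\<close>, \<open>v\<close> split off in front.\<close>
    have r: "sum_list (map f r) \<ge> length r / 2"
      using less.prems by (intro conjunct1[OF less.hyps]) (auto simp: p successively_Cons)
    have "f u + f v > 1"
      using less.prems assms(1) by (simp add: p)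
    with r show ?thesis by (simp add: p field_simps)
  qed simp
qed

text \<open>For a cycle on \<open>2 * s + 1\<close> vertices, \<open>s + 1\<close> is half of the
  length plus one. List sums, unlike sums over \<open>set c\<close>, split directly when a cycle is
  cut.\<close>

lemma elp_feasible_iff:
  "x \<in> elp_feasible E \<longleftrightarrow>
     (\<forall>u v. E u v \<longrightarrow> x $ u + x $ v \<ge> 1) \<and>
     (\<forall>c. odd_cycle E c \<longrightarrow> sum_list (map (($) x) c) \<ge> (length c + 1) / 2) \<and>
     (\<forall>v. x $ v \<ge> 0)"
proof -
  have "(\<forall>s. odd_cycle E c \<and> length c = 2 * s + 1 \<longrightarrow> (\<Sum>v \<in> set c. x $ v) \<ge> real s + 1) \<longleftrightarrow>
      (odd_cycle E c \<longrightarrow> sum_list (map (($) x) c) \<ge> (length c + 1) / 2)" for c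
  proof (cases "odd_cycle E c")
    case True
    then have d: "distinct c" and "odd (length c)"
      by (auto simp: odd_cycle_def is_cycle_def)
    then obtain s where "length c = 2 * s + 1" by (auto elim: oddE)
    then show ?thesis
      using True by (auto simp: sum_list_distinct_conv_sum_set[OF d] field_simps)
  qed simp
  then show ?thesis
    unfolding elp_feasible_def by auto
qed

text \<open>Of the total weight \<open>s + 1\<close>, the even path left after deleting
  \<open>u\<close> already takes at least \<open>s\<close>.\<close>

lemma tight_odd_cycle_vertex_le_1:
  fixes f :: "'a \<Rightarrow> real"
  assumes edge: "\<And>u v. E u v \<Longrightarrow> f u + f v > 1"
    and c: "odd_cycle E c" "sum_list (map f c) = (length c + 1) / 2" and u: "u \<in> set c"
  shows "f u \<le> 1"
proof -
  obtain as bs where split: "c = as @ u # bs"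
    using u by (meson split_list)
  have "odd_cycle E (u # bs @ as)"
    using odd_cycle_rotate[of E as "u # bs"] c(1) by (simp add: split)
  then have "successively E (bs @ as)" "even (length (bs @ as))"
    by (auto simp: odd_cycle_def is_cycle_iff_successively successively_Cons)
  then have "sum_list (map f (bs @ as)) \<ge> length (bs @ as) / 2"
    using even_path_weight[of E f] edge by blast
  then show ?thesis
    using c(2) by (simp add: split field_simps)
qed

text \<open>The chord bypasses the arc \<open>ms\<close>. What remains is an odd cycle weighing at
  least \<open>(length rs + 3) / 2\<close>, and the nonempty even path \<open>ms\<close> adds more
  than \<open>length ms / 2\<close>.\<close>

lemma odd_cycle_even_chord_not_tight:
  fixes f :: "'a \<Rightarrow> real"
  assumes edge: "\<And>u v. E u v \<Longrightarrow> f u + f v > 1"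
    and cyc: "\<And>c. odd_cycle E c \<Longrightarrow> sum_list (map f c) \<ge> (length c + 1) / 2"
    and c: "odd_cycle E (a # ms @ b # rs)"
    and ms: "even (length ms)" "ms \<noteq> []" and rs: "rs \<noteq> []" and ab: "E a b"
  shows "sum_list (map f (a # ms @ b # rs)) > (length (a # ms @ b # rs) + 1) / 2"
proof -
  \<comment> \<open>Since \<open>rs\<close> is nonempty, the shortened cycle still has at least
    three vertices.\<close>
  have "odd_cycle E (a # b # rs)"
    using c ms rs ab
    by (cases rs)
       (auto simp: odd_cycle_def is_cycle_iff_successively successively_append_iff successively_Cons)
  from cyc[OF this] have 1: "sum_list (map f (a # b # rs)) \<ge> (length rs + 3) / 2"
    by (simp add: add.commute)
  have "successively E ms"
    using c by (auto simp: odd_cycle_def is_cycle_iff_successively successively_append_iff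
        successively_Cons)
  then have "sum_list (map f ms) > length ms / 2"
    using even_path_weight[of E f ms] edge ms by blast
  with 1 show ?thesis by (simp add: field_simps)
qed

text \<open>The ends of a chord split the other vertices into two arcs with an odd total, so one arc
  is even and the preceding bound contradicts tightness.\<close>

lemma tight_odd_cycle_chordless:
  fixes f :: "'a \<Rightarrow> real"
  assumes "symp E"
    and edge: "\<And>u v. E u v \<Longrightarrow> f u + f v > 1"
    and cyc: "\<And>c. odd_cycle E c \<Longrightarrow> sum_list (map f c) \<ge> (length c + 1) / 2"
    and c: "odd_cycle E c" and tight: "sum_list (map f c) = (length c + 1) / 2"
  shows "chordless_odd_cycle E c"
proof -
  have no_chord: False
    if ij: "i < j" "j < length c" and nonadj: "j \<noteq> Suc i mod length c" "i \<noteq> Suc j mod length c"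
      and chord: "E (c ! i) (c ! j)" for i j
  proof -
    \<comment> \<open>Removing the chord ends \<open>a\<close> and \<open>b\<close> leaves the arcs
      \<open>ms\<close> and \<open>bs @ as\<close>; the second one runs through the end of the
      list.\<close>
    define as a where "as = take i c" and "a = c ! i"
    define ms b where "ms = take (j - Suc i) (drop (Suc i) c)" and "b = c ! j"
    define bs where "bs = drop (Suc j) c"
    have "drop (Suc i) c = ms @ drop (j - Suc i) (drop (Suc i) c)"
      by (simp add: ms_def del: drop_drop)
    also have "drop (j - Suc i) (drop (Suc i) c) = b # bs"
      using ij by (simp add: b_def bs_def Cons_nth_drop_Suc)
    finally have split: "c = as @ a # ms @ b # bs"
      using ij id_take_nth_drop[of i c] by (simp add: as_def a_def)
    \<comment> \<open>An empty arc would make \<open>a\<close> and \<open>b\<close> consecutive on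
      the cycle, for \<open>bs @ as\<close> by way of the closing edge.\<close>
    have ms: "ms \<noteq> []"
      using ij nonadj(1) by (auto simp: ms_def)
    have rs: "bs @ as \<noteq> []"
    proof
      assume "bs @ as = []"
      then have "i = 0" "Suc j = length c"
        using ij by (auto simp: as_def bs_def)
      with nonadj(2) show False by simp
    qed
    have E: "E a b" "E b a"
      using chord \<open>symp E\<close> by (auto simp: a_def b_def dest: sympD)
    have c1: "odd_cycle E (a # ms @ b # (bs @ as))"
      using odd_cycle_rotate[of E as "a # ms @ b # bs"] c by (simp add: split)
    \<comment> \<open>Starting from \<open>b\<close> exchanges the roles of the two arcs, so that
      either one can be the bypassed arc.\<close>
    have c2: "odd_cycle E (b # (bs @ as) @ a # ms)"
      using odd_cycle_rotate[of E "a # ms" "b # bs @ as"] c1 by simp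
    have "even (length ms) \<or> even (length (bs @ as))"
      using c by (auto simp: split odd_cycle_def)
    then show False
    proof
      assume "even (length ms)"
      from odd_cycle_even_chord_not_tight[OF edge cyc c1 this ms rs E(1)] tight
      show False by (simp add: split field_simps)
    next
      assume "even (length (bs @ as))"
      from odd_cycle_even_chord_not_tight[OF edge cyc c2 this rs ms E(2)] tight
      show False by (simp add: split field_simps)
    qed
  qed
  show ?thesis
    unfolding chordless_odd_cycle_def
  proof (intro conjI c allI impI notI)
    fix i j
    assume "i < length c" "j < length c" and E: "E (c ! i) (c ! j)"
      and "i \<noteq> j \<and> j \<noteq> Suc i mod length c \<and> i \<noteq> Suc j mod length c"
    then show False
      using no_chord[of i j] no_chord[of j i] sympD[OF \<open>symp E\<close> E] by (cases "i < j") auto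
  qed
qed

section \<open>Feasible directions and the bound by 1\<close>

lemma eventually_affine_nonneg:
  fixes a b :: real
  assumes "a \<ge> 0" "a > 0 \<or> b \<ge> 0"
  shows "\<forall>\<^sub>F t in at_right 0. a + t * b \<ge> 0"
proof (cases "b \<ge> 0")
  case True
  have "\<forall>\<^sub>F t::real in at_right 0. t > 0"
    by (rule eventually_at_right_less)
  then show ?thesis
    by eventually_elim (use True assms(1) in simp)
next
  case False
  have "((\<lambda>t. a + t * b) \<longlongrightarrow> a + 0 * b) (at_right 0)"
    by (intro tendsto_intros)
  then have "\<forall>\<^sub>F t in at_right 0. a + t * b > 0"
    using assms False by (intro order_tendstoD(1)) auto
  then show ?thesis
    by eventually_elim simp
qed

text \<open>Slack constraints survive a small move by continuity, active ones because
  \<open>d\<close> does not decrease them. There are finitely many constraints, so one range of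
  \<open>t\<close> serves all; edges are slack and put no condition on \<open>d\<close>.\<close>

lemma eventually_feasible_direction:
  assumes x: "x \<in> elp_feasible E"
    and edge: "\<And>u v. E u v \<Longrightarrow> x $ u + x $ v > 1"
    and cyc: "\<And>c. odd_cycle E c \<Longrightarrow> sum_list (map (($) x) c) = (length c + 1) / 2 \<Longrightarrow>
                sum_list (map (($) d) c) \<ge> 0"
    and nonneg: "\<And>v. x $ v > 0 \<or> d $ v \<ge> 0"
  shows "\<forall>\<^sub>F t in at_right 0. x + t *\<^sub>R d \<in> elp_feasible E"
proof -
  have 1: "\<forall>\<^sub>F t in at_right 0. \<forall>u v. E u v \<longrightarrow> (x $ u + x $ v - 1) + t * (d $ u + d $ v) \<ge> 0"
  proof (intro eventually_all_finite)
    fix u v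
    show "\<forall>\<^sub>F t in at_right 0. E u v \<longrightarrow> (x $ u + x $ v - 1) + t * (d $ u + d $ v) \<ge> 0"
      using edge[of u v]
      by (cases "E u v") (auto intro!: eventually_affine_nonneg)
  qed
  have 2: "\<forall>\<^sub>F t in at_right 0. \<forall>c \<in> {c. odd_cycle E c}.
      (sum_list (map (($) x) c) - (length c + 1) / 2) + t * sum_list (map (($) d) c) \<ge> 0"
  proof (intro eventually_ball_finite finite_odd_cycles ballI eventually_affine_nonneg)
    fix c assume "c \<in> {c. odd_cycle E c}"
    then have c: "odd_cycle E c" by simp
    with x have *: "sum_list (map (($) x) c) \<ge> (length c + 1) / 2"
      by (simp add: elp_feasible_iff)
    then show "0 \<le> sum_list (map (($) x) c) - (length c + 1) / 2" by simp
    show "0 < sum_list (map (($) x) c) - (length c + 1) / 2 \<or> 0 \<le> sum_list (map (($) d) c)"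
      using cyc[OF c] * by linarith
  qed
  have 3: "\<forall>\<^sub>F t in at_right 0. \<forall>v. x $ v + t * d $ v \<ge> 0"
    using x nonneg
    by (intro eventually_all_finite eventually_affine_nonneg) (auto simp: elp_feasible_iff)
  have sum: "sum_list (map (($) (x + t *\<^sub>R d)) c) =
      sum_list (map (($) x) c) + t * sum_list (map (($) d) c)" for t c
    by (induction c) (auto simp: algebra_simps)
  from 1 2 3 show ?thesis
    by eventually_elim (auto simp: elp_feasible_iff sum algebra_simps)
qed

lemma elp_optimal_le_1:
  assumes opt: "elp_optimal E x" and edge: "\<And>u v. E u v \<Longrightarrow> x $ u + x $ v > 1"
  shows "x $ u \<le> 1"
proof (rule ccontr)
  assume u: "\<not> x $ u \<le> 1"
  have x: "x \<in> elp_feasible E"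
    using opt by (simp add: elp_optimal_def)
  define d :: "real ^ 'a" where "d = - axis u 1"
  have "\<forall>\<^sub>F t in at_right 0. x + t *\<^sub>R d \<in> elp_feasible E"
  proof (rule eventually_feasible_direction[OF x edge])
    fix c assume c: "odd_cycle E c" "sum_list (map (($) x) c) = (length c + 1) / 2"
    \<comment> \<open>A tight cycle through \<open>u\<close> would force
      \<open>x $ u \<le> 1\<close>; hence \<open>d\<close> vanishes on every tight cycle.\<close>
    have "u \<notin> set c"
      using tight_odd_cycle_vertex_le_1[of E "($) x", OF edge c] u by blast
    then have "map (($) d) c = map (\<lambda>_. 0) c"
      by (auto simp: d_def axis_def)
    then show "sum_list (map (($) d) c) \<ge> 0"
      by (simp del: map_eq_conv)
  next
    fix v show "x $ v > 0 \<or> d $ v \<ge> 0"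
      using u by (auto simp: d_def axis_def)
  qed
  then have "\<forall>\<^sub>F t::real in at_right 0. x + t *\<^sub>R d \<in> elp_feasible E \<and> t > 0"
    by (intro eventually_conj eventually_at_right_less)
  then obtain t :: real where t: "x + t *\<^sub>R d \<in> elp_feasible E" "t > 0"
    using eventually_happens[of _ "at_right (0::real)"] trivial_limit_at_right_real by blast
  \<comment> \<open>The move lowers the objective by \<open>t\<close>, against optimality.\<close>
  have "(\<Sum>v\<in>UNIV. (x + t *\<^sub>R d) $ v) = (\<Sum>v\<in>UNIV. x $ v) - t"
    by (simp add: d_def axis_def sum_subtractf if_distrib[of "(*) t"] cong: if_cong)
  moreover have "(\<Sum>v\<in>UNIV. x $ v) \<le> (\<Sum>v\<in>UNIV. (x + t *\<^sub>R d) $ v)"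
    using opt t(1) unfolding elp_optimal_def by blast
  ultimately show False using t(2) by simp
qed

section \<open>Tight cycles at a vertex of the polyhedron\<close>

lemma inner_incidence_vector:
  assumes "distinct c"
  shows "w \<bullet> incidence_vector c = sum_list (map (($) w) c)"
proof -
  have "w \<bullet> incidence_vector c = (\<Sum>i\<in>UNIV. if i \<in> set c then w $ i else 0)"
    by (auto simp: inner_vec_def incidence_vector_def intro!: sum.cong)
  also have "\<dots> = (\<Sum>i\<in>set c. w $ i)"
    by (simp add: sum.If_cases)
  finally show ?thesis
    using assms by (simp add: sum_list_distinct_conv_sum_set)
qed

text \<open>Otherwise some nonzero \<open>w\<close> is orthogonal to all tight cycles. Moving along
  \<open>w\<close> or \<open>- w\<close> then keeps every active constraint active, which puts
  \<open>x\<close> in the interior of a feasible segment.\<close>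

lemma tight_odd_cycles_span:
  assumes ext: "x extreme_point_of elp_feasible E"
    and edge: "\<And>u v. E u v \<Longrightarrow> x $ u + x $ v > 1"
    and pos: "\<And>v. x $ v > 0"
  shows "span (incidence_vector ` {c. odd_cycle E c \<and>
           sum_list (map (($) x) c) = (length c + 1) / 2}) = UNIV" (is "span (_ ` ?T) = _")
proof (rule ccontr)
  assume "span (incidence_vector ` ?T) \<noteq> UNIV"
  then obtain w where w: "w \<noteq> 0" "\<forall>y \<in> span (incidence_vector ` ?T). w \<bullet> y = 0"
    using span_not_UNIV_orthogonal by blast
  have tight: "sum_list (map (($) w) c) = 0" if "c \<in> ?T" for c
  proof -
    have "w \<bullet> incidence_vector c = 0"
      using w(2) that by (blast intro: span_base)
    then show ?thesis
      using that by (subst (asm) inner_incidence_vector) (auto simp: odd_cycle_def is_cycle_def)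
  qed
  have sum_minus: "sum_list (map (($) (- w)) c) = - sum_list (map (($) w) c)" for c
    by (induction c) auto
  have x: "x \<in> elp_feasible E"
    using ext by (simp add: extreme_point_of_def)
  have "\<forall>\<^sub>F t in at_right 0. x + t *\<^sub>R w \<in> elp_feasible E"
    using tight pos by (intro eventually_feasible_direction[OF x edge]) auto
  moreover have "\<forall>\<^sub>F t in at_right 0. x + t *\<^sub>R (- w) \<in> elp_feasible E"
    using tight pos by (intro eventually_feasible_direction[OF x edge]) (auto simp: sum_minus)
  moreover have "\<forall>\<^sub>F t::real in at_right 0. t > 0"
    by (rule eventually_at_right_less)
  ultimately have "\<forall>\<^sub>F t::real in at_right 0.
      x + t *\<^sub>R w \<in> elp_feasible E \<and> x + t *\<^sub>R (- w) \<in> elp_feasible E \<and> t > 0"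
    by eventually_elim blast
  then obtain t :: real where t: "x + t *\<^sub>R w \<in> elp_feasible E" "x + t *\<^sub>R (- w) \<in> elp_feasible E"
      "t > 0"
    using eventually_happens[of _ "at_right (0::real)"] trivial_limit_at_right_real by blast
  have "x = midpoint (x + t *\<^sub>R w) (x + t *\<^sub>R (- w))"
    by (simp add: midpoint_def vec_eq_iff)
  moreover have "x + t *\<^sub>R w \<noteq> x + t *\<^sub>R (- w)"
    using w(1) t(3) by (auto simp: vec_eq_iff)
  ultimately have "x \<in> open_segment (x + t *\<^sub>R w) (x + t *\<^sub>R (- w))"
    by (metis midpoint_in_open_segment)
  with ext t show False
    unfolding extreme_point_of_def by blast
qed

text \<open>Extract a basis from the incidence vectors and choose one cycle for each basis vector.
  This choice makes \<open>incidence_vector\<close> injective on \<open>C\<close>, so different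
  lists of the same cycle are not counted twice.\<close>

lemma spanning_cycles_lin_indep:
  fixes T :: "'n::finite list set"
  assumes "span (incidence_vector ` T) = UNIV"
  obtains C where "C \<subseteq> T" "lin_indep_cycles C" "card C = CARD('n)"
proof -
  obtain B where B: "B \<subseteq> incidence_vector ` T" "independent B"
      "card B = dim (incidence_vector ` T)"
    using basis_exists[of "incidence_vector ` T"] by metis
  obtain C where C: "C \<subseteq> T" "inj_on incidence_vector C" "B = incidence_vector ` C"
    using subset_image_inj[of B incidence_vector T] B(1) by blast
  have "card C = CARD('n)"
    using B(3) C card_image[OF C(2)] assms dim_span[of "incidence_vector ` T"] by simp
  with that C B(2) show thesis
    unfolding lin_indep_cycles_def by blast
qed

theorem theorem2:
  fixes E :: "'n::finite \<Rightarrow> 'n \<Rightarrow> bool"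
  assumes "simple_graph E"
    and "contains_triangle E \<or> no_isolated_vertices E"
    and "contains_triangle E \<or> few_indep_chordless_odd_cycles E"
  shows "active_edge_hypothesis E"
  unfolding active_edge_hypothesis_def
proof (intro allI impI)
  fix x assume "elp_basic_feasible E x \<and> elp_optimal E x"
  then have ext: "x extreme_point_of elp_feasible E" and opt: "elp_optimal E x"
    by (auto simp: elp_basic_feasible_def)
  then have feas: "x \<in> elp_feasible E"
    by (simp add: elp_optimal_def)
  show "contains_triangle E \<or> (\<exists>i j. E i j \<and> x $ i + x $ j = 1) \<or>
        (\<exists>i j. E i j \<and> x $ i + x $ j \<ge> 4 / 3) \<or> (\<exists>i. x $ i = 1)"
  proof (rule ccontr)
    assume neg: "\<not> ?thesis"
    then have few: "few_indep_chordless_odd_cycles E" and no_iso: "no_isolated_vertices E"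
      using assms by auto
    \<comment> \<open>Feasibility gives the weak inequality; the negated second alternative excludes
      equality.\<close>
    have edge: "x $ u + x $ v > 1" if "E u v" for u v
      using neg that feas by (force simp: elp_feasible_iff less_le)
    have pos: "x $ v > 0" for v
    proof (rule ccontr)
      assume v: "\<not> x $ v > 0"
      \<comment> \<open>A neighbour \<open>u\<close> of a vertex \<open>v\<close> of weight zero
        would weigh more than 1, which optimality forbids.\<close>
      obtain u where "E v u"
        using no_iso by (auto simp: no_isolated_vertices_def)
      then show False
        using edge[of v u] v elp_optimal_le_1[OF opt edge, of u] by simp
    qed
    obtain C where C: "C \<subseteq> {c. odd_cycle E c \<and> sum_list (map (($) x) c) = (length c + 1) / 2}"
        "lin_indep_cycles C" "card C = CARD('n)"
      using spanning_cycles_lin_indep[OF tight_odd_cycles_span[OF ext edge pos]] by blast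
    have "chordless_odd_cycle E c" if "c \<in> C" for c
      using assms(1) edge feas C(1) that
      by (intro tight_odd_cycle_chordless[of E "($) x"])
         (auto simp: simple_graph_def elp_feasible_iff)
    then have "card C < CARD('n)"
      using few C(2) unfolding few_indep_chordless_odd_cycles_def by blast
    with C(3) show False by simp
  qed
qed

end
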